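(* Let $(\mathfrak g,\pi)$ and $(\mathfrak h,\mu)$ be finite-dimensional real $3$-Lie algebras and let $f$ be a $3$-Lie algebra morphism from $(\mathfrak g,\pi)$ to $(\mathfrak h,\mu)$. If $H^2(f)=0$, then $f$ is stable.
   Context: A $3$-Lie algebra is a vector space $\mathfrak g$ with a linear map $\pi:\wedge^3\mathfrak g\to\mathfrak g$ such that $\pi(x_1,x_2,\pi(x_3,x_4,x_5))=\pi(\pi(x_1,x_2,x_3),x_4,x_5)+\pi(x_3,\pi(x_1,x_2,x_4),x_5)+\pi(x_3,x_4,\pi(x_1,x_2,x_5))$ for all $x_i\in\mathfrak g$. A $3$-Lie algebra morphism $(\mathfrak g,\pi)\to(\mathfrak h,\mu)$ is a linear map $f$ with $f(\pi(x,y,z))=\mu(f(x),f(y),f(z))$. The morphism $f$ from $(\mathfrak g,\pi)$ to $(\mathfrak h,\mu)$ is called stable if for any $3$-Lie algebra structure $\varpi$ on $\mathfrak h$ that is $\mathcal C^0$-close to $\mu$ there exists a $3$-Lie algebra morphism $f'$ from $(\mathfrak g,\pi)$ to $(\mathfrak h,\varpi)$ which is $\mathcal C^0$-close to $f$. That is: for every neighborhood $\mathcal V$ of $f$ in $\mathrm{Hom}(\mathfrak g,\mathfrak h)$ there is a neighborhood $\mathcal W$ of $\mu$ in $\mathrm{Hom}(\wedge^3\mathfrak h,\mathfrak h)$ such that for every $3$-Lie algebra structure $\varpi\in\mathcal W$ on $\mathfrak h$ there is a $3$-Lie algebra morphism $f'\in\mathcal V$ from $(\mathfrak g,\pi)$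 to $(\mathfrak h,\varpi)$. Cohomology of $f$: $C^1(f)=\mathrm{Hom}(\mathfrak g,\mathfrak h)$, $C^2(f)=\mathrm{Hom}(\wedge^3\mathfrak g,\mathfrak h)$, $C^3(f)=\mathrm{Hom}(\wedge^2\mathfrak g\otimes\wedge^3\mathfrak g,\mathfrak h)$ (the last space is written $\mathrm{Hom}(\wedge^2\mathfrak g\otimes\wedge^2\mathfrak g\wedge\mathfrak g,\mathfrak h)$). For $\theta\in C^n(f)$, $n\ge1$, $\mathfrak X_i=x_i\wedge y_i\in\wedge^2\mathfrak g$, $x\in\mathfrak g$, with $\pi(\mathfrak X_i,z)=\pi(x_i,y_i,z)$, $$\begin{aligned}\delta(\theta)(\mathfrak X_1,\dots,\mathfrak X_n,x)=&\sum_{1\le i<j\le n}(-1)^i\theta\big(\mathfrak X_1,\dots,\widehat{\mathfrak X_i},\dots,\mathfrak X_{j-1},\pi(\mathfrak X_i,x_j)\wedge y_j+x_j\wedge\pi(\mathfrak X_i,y_j),\dots,\mathfrak X_n,x\big)\\&+\sum_{i=1}^n(-1)^i\theta(\mathfrak X_1,\dots,\widehat{\mathfrak X_i},\dots,\mathfrak X_n,\pi(\mathfrak X_i,x))\\&+\sum_{i=1}^n(-1)^{i+1}\mu\big(f(x_i),f(y_i),\theta(\mathfrak X_1,\dots,\widehat{\mathfrak X_i},\dots,\mathfrak X_n,x)\big)\\&+(-1)^{n-1}\Big(\mu(\theta(\mathfrak X_1,\dots,\mathfrak X_{n-1},x_n),f(y_n),f(x))+\mu(f(x_n),\theta(\mathfrak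 X_1,\dots,\mathfrak X_{n-1},y_n),f(x))\Big).\end{aligned}$$ $H^2(f)=\ker(\delta|_{C^2(f)})/\delta(C^1(f))$. *)

theory Defs
  imports "HOL-Analysis.Analysis"
begin

text \<open>
  Vector spaces are types of class \<open>real_normed_vector\<close>; finite dimension is a hypothesis of the
  theorem. (The class \<open>euclidean_space\<close> would exclude the zero space and fix an inner product.)
  On finite-dimensional spaces every linear map is bounded and all norms induce the same topology,
  so \<open>'a \<Rightarrow>\<^sub>L 'b\<close> is the full space of linear maps with its usual topology, and
  \<open>'a \<Rightarrow>\<^sub>L 'a \<Rightarrow>\<^sub>L 'a \<Rightarrow>\<^sub>L 'b\<close> is the space of all trilinear maps.
\<close>

type_synonym 'a trilin = "'a \<Rightarrow>\<^sub>L 'a \<Rightarrow>\<^sub>L 'a \<Rightarrow>\<^sub>L 'a"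

abbreviation app3 :: "'a::real_normed_vector trilin \<Rightarrow> 'a \<Rightarrow> 'a \<Rightarrow> 'a \<Rightarrow> 'a"
  where "app3 p x y z \<equiv> blinfun_apply (blinfun_apply (blinfun_apply p x) y) z"

text \<open>The space \<open>Hom(\<and>\<^sup>3 V, V)\<close>, as the alternating maps among the trilinear ones.\<close>

definition alternating3 :: "'a::real_normed_vector trilin set"
  where "alternating3 =
    {p. (\<forall>x y. app3 p x x y = 0) \<and> (\<forall>x y. app3 p x y y = 0) \<and> (\<forall>x y. app3 p x y x = 0)}"

definition three_lie_structure :: "'a::real_normed_vector trilin \<Rightarrow> bool"
  where "three_lie_structure p \<longleftrightarrow> p \<in> alternating3 \<and>
    (\<forall>x1 x2 x3 x4 x5.
       app3 p x1 x2 (app3 p x3 x4 x5) =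
         app3 p (app3 p x1 x2 x3) x4 x5
       + app3 p x3 (app3 p x1 x2 x4) x5
       + app3 p x3 x4 (app3 p x1 x2 x5))"

definition three_lie_morphism ::
    "'g::real_normed_vector trilin \<Rightarrow> 'h::real_normed_vector trilin \<Rightarrow> ('g \<Rightarrow>\<^sub>L 'h) \<Rightarrow> bool"
  where "three_lie_morphism p m f \<longleftrightarrow>
    (\<forall>x y z. blinfun_apply f (app3 p x y z) =
       app3 m (blinfun_apply f x) (blinfun_apply f y) (blinfun_apply f z))"

definition stable_morphism ::
    "'g::real_normed_vector trilin \<Rightarrow> 'h::real_normed_vector trilin \<Rightarrow> ('g \<Rightarrow>\<^sub>L 'h) \<Rightarrow> bool"
  where "stable_morphism p m f \<longleftrightarrow>
    (\<forall>V. open V \<and> f \<in> V \<longrightarrow>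
      (\<exists>W. openin (top_of_set alternating3) W \<and> m \<in> W \<and>
        (\<forall>w\<in>W. three_lie_structure w \<longrightarrow> (\<exists>f'\<in>V. three_lie_morphism p w f'))))"

text \<open>
  A cochain of degree \<open>n \<ge> 2\<close> is a linear map on the tensor product of \<open>n - 2\<close> copies of
  \<open>\<and>\<^sup>2 g\<close> with \<open>\<and>\<^sup>2 g \<and> g = \<and>\<^sup>3 g\<close>; one of degree 1 is a linear map on \<open>g\<close>.
  It is represented by its values on decomposable elements: a function of a list of \<open>n - 1\<close> pairs
  \<open>(x, y)\<close>, standing for \<open>x \<and> y\<close>, and of a last argument in \<open>g\<close>. The wedge of the last pair with
  the last argument is accounted for by the final clause, which together with the preceding ones
  makes the function alternating in these three vectors. The value is 0 on lists of other lengths,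
  so that equality of functions is equality of cochains.
\<close>

definition cochains :: "nat \<Rightarrow> (('g::real_vector \<times> 'g) list \<Rightarrow> 'g \<Rightarrow> 'h::real_vector) set"
  where "cochains n = {\<theta>.
    (\<forall>Xs x. length Xs \<noteq> n - 1 \<longrightarrow> \<theta> Xs x = 0) \<and>
    (\<forall>Xs. length Xs = n - 1 \<longrightarrow> linear (\<lambda>x. \<theta> Xs x)) \<and>
    (\<forall>Xs i x. length Xs = n - 1 \<and> i < n - 1 \<longrightarrow>
       (\<forall>v. linear (\<lambda>u. \<theta> (Xs[i := (u, v)]) x)) \<and>
       (\<forall>u. linear (\<lambda>v. \<theta> (Xs[i := (u, v)]) x)) \<and>
       (\<forall>u. \<theta> (Xs[i := (u, u)]) x = 0)) \<and>
    (\<forall>Xs u v. length (Xs @ [(u, v)]) = n - 1 \<longrightarrow> \<theta> (Xs @ [(u, v)]) v = 0)}"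

text \<open>Omit the \<open>i\<close>-th entry of a list, counting from 1.\<close>

definition omit :: "nat \<Rightarrow> 'a list \<Rightarrow> 'a list"
  where "omit i Xs = take (i - 1) Xs @ drop i Xs"

text \<open>
  The coboundary of a degree \<open>n\<close> cochain, with indices counted from 1, so that \<open>X\<^sub>i\<close> is
  \<open>Xs ! (i - 1)\<close>. In the first sum, the cochain at a sum of two decomposable elements of \<open>\<and>\<^sup>2 g\<close>
  is written as the sum of its two values.
\<close>

definition coboundary ::
    "'g::real_normed_vector trilin \<Rightarrow> 'h::real_normed_vector trilin \<Rightarrow> ('g \<Rightarrow>\<^sub>L 'h) \<Rightarrow> nat \<Rightarrow>
      (('g \<times> 'g) list \<Rightarrow> 'g \<Rightarrow> 'h) \<Rightarrow> (('g \<times> 'g) list \<Rightarrow> 'g \<Rightarrow> 'h)"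
  where "coboundary p m f n \<theta> = (\<lambda>Xs x.
    if length Xs \<noteq> n then 0
    else
      let X = (\<lambda>i. fst (Xs ! (i - 1))); Y = (\<lambda>i. snd (Xs ! (i - 1))); F = blinfun_apply f in
        (\<Sum>j = 1..n. \<Sum>i = 1..<j. (-1) ^ i *\<^sub>R
           (\<theta> (omit i (Xs[j - 1 := (app3 p (X i) (Y i) (X j), Y j)])) x
          + \<theta> (omit i (Xs[j - 1 := (X j, app3 p (X i) (Y i) (Y j))])) x))
      + (\<Sum>i = 1..n. (-1) ^ i *\<^sub>R \<theta> (omit i Xs) (app3 p (X i) (Y i) x))
      + (\<Sum>i = 1..n. (-1) ^ (i + 1) *\<^sub>R app3 m (F (X i)) (F (Y i)) (\<theta> (omit i Xs) x))
      + (-1) ^ (n - 1) *\<^sub>R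
          (app3 m (\<theta> (take (n - 1) Xs) (X n)) (F (Y n)) (F x)
         + app3 m (F (X n)) (\<theta> (take (n - 1) Xs) (Y n)) (F x)))"

definition cocycles2 ::
    "'g::real_normed_vector trilin \<Rightarrow> 'h::real_normed_vector trilin \<Rightarrow> ('g \<Rightarrow>\<^sub>L 'h) \<Rightarrow>
      (('g \<times> 'g) list \<Rightarrow> 'g \<Rightarrow> 'h) set"
  where "cocycles2 p m f = {\<theta> \<in> cochains 2. coboundary p m f 2 \<theta> = (\<lambda>Xs x. 0)}"

definition coboundaries2 ::
    "'g::real_normed_vector trilin \<Rightarrow> 'h::real_normed_vector trilin \<Rightarrow> ('g \<Rightarrow>\<^sub>L 'h) \<Rightarrow>
      (('g \<times> 'g) list \<Rightarrow> 'g \<Rightarrow> 'h) set"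
  where "coboundaries2 p m f = coboundary p m f 1 ` cochains 1"

text \<open>The quotient space, as the set of cosets; its zero element is the coset \<open>coboundaries2 p m f\<close>.\<close>

definition cohomology2 ::
    "'g::real_normed_vector trilin \<Rightarrow> 'h::real_normed_vector trilin \<Rightarrow> ('g \<Rightarrow>\<^sub>L 'h) \<Rightarrow>
      (('g \<times> 'g) list \<Rightarrow> 'g \<Rightarrow> 'h) set set"
  where "cohomology2 p m f =
    (\<lambda>\<theta>. (\<lambda>\<beta> Xs x. \<theta> Xs x + \<beta> Xs x) ` coboundaries2 p m f) ` cocycles2 p m f"

end

theory Submission imports Defs
begin

text \<open>
  For a structure \<open>w\<close> on \<open>h\<close> and a linear map \<open>\<phi>\<close>, let \<open>\<Phi>\<close> be the defect
  \<open>\<phi>(\<pi>(x, y, z)) - w(\<phi> x, \<phi> y, \<phi> z)\<close>. Its derivative in \<open>\<phi>\<close> at \<open>(\<mu>, f)\<close> is \<open>-\<delta>\<close> on \<open>C\<^sup>1(f)\<close>, and the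
  fundamental identities of \<open>\<pi>\<close> and \<open>w\<close> show that the degree 2 coboundary operator \<open>K\<^sub>w\<close>, written with \<open>w\<close> and
  \<open>\<phi>\<close> in place of \<open>\<mu>\<close> and \<open>f\<close>, annihilates \<open>\<Phi>\<close>. If \<open>H\<^sup>2(f) = 0\<close>, there are linear maps \<open>S\<close> and \<open>T\<close>
  with \<open>D S + T K = id\<close> on \<open>C\<^sup>2(f)\<close>, where \<open>D = -\<delta>\<close> on \<open>C\<^sup>1(f)\<close> and \<open>K = \<delta>\<close> on \<open>C\<^sup>2(f)\<close>. For \<open>w\<close> close to \<open>\<mu>\<close>,
  a contraction argument yields \<open>\<phi>\<close> close to \<open>f\<close> with \<open>D S \<Phi> = 0\<close>. Then
  \<open>\<Phi> = T K \<Phi> = T (K - K\<^sub>w) \<Phi>\<close>, and \<open>T (K - K\<^sub>w)\<close> has norm less than 1, so \<open>\<Phi> = 0\<close>.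
\<close>

section \<open>Finite-dimensional normed spaces\<close>

definition finite_dim :: "'a::real_vector itself \<Rightarrow> bool"
  where "finite_dim _ \<longleftrightarrow> (\<exists>B::'a set. finite B \<and> span B = UNIV)"

lemma complete_Times:
  fixes S :: "'a::metric_space set" and T :: "'b::metric_space set"
  assumes "complete S" "complete T"
  shows "complete (S \<times> T)"
  unfolding complete_def
proof (intro allI impI, elim conjE)
  fix X assume X: "\<forall>n. X n \<in> S \<times> T" and C: "Cauchy X"
  have "\<forall>n. fst (X n) \<in> S" "\<forall>n. snd (X n) \<in> T"
    using X by (auto simp: mem_Times_iff)
  then obtain a b where a: "a \<in> S" "(\<lambda>n. fst (X n)) \<longlonglongrightarrow> a" and b: "b \<in> T" "(\<lambda>n. snd (X n)) \<longlonglongrightarrow> b"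
    using assms Cauchy_fst[OF C] Cauchy_snd[OF C] unfolding complete_def by meson
  then have "X \<longlonglongrightarrow> (a, b)"
    using tendsto_Pair[OF a(2) b(2)] by simp
  then show "\<exists>l\<in>S \<times> T. X \<longlonglongrightarrow> l"
    using a b by blast
qed

text \<open>Take \<open>d\<close> to be the distance from \<open>b\<close> to \<open>U\<close>. It
  is positive because a complete \<open>U\<close> is closed, and for nonzero \<open>t\<close>,
  dividing \<open>t *\<^sub>R b + w\<close> by \<open>t\<close> compares \<open>b\<close> with a
  point of \<open>U\<close>.\<close>

lemma norm_line_plus_complete_subspace:
  fixes b :: "'a::real_normed_vector"
  assumes "complete U" "subspace U" "b \<notin> U"
  obtains d where "d > 0" "\<And>t w. w \<in> U \<Longrightarrow> d * \<bar>t\<bar> \<le> norm (t *\<^sub>R b + w)"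
proof
  show "infdist b U > 0"
    using assms by (intro infdist_pos_not_in_closed complete_imp_closed) (auto dest: subspace_0)
  fix t w assume w: "w \<in> U"
  show "infdist b U * \<bar>t\<bar> \<le> norm (t *\<^sub>R b + w)"
  proof (cases "t = 0")
    case False
    have "(- 1 / t) *\<^sub>R w \<in> U"
      using w assms(2) by (rule subspace_scale[rotated])
    then have "infdist b U \<le> dist b ((- 1 / t) *\<^sub>R w)"
      by (rule infdist_le)
    then have "\<bar>t\<bar> * infdist b U \<le> \<bar>t\<bar> * norm (b + (1 / t) *\<^sub>R w)"
      by (simp add: dist_norm mult_left_mono)
    also have "\<dots> = norm (t *\<^sub>R (b + (1 / t) *\<^sub>R w))"
      by simp
    also have "t *\<^sub>R (b + (1 / t) *\<^sub>R w) = t *\<^sub>R b + w"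
      using False by (simp add: scaleR_add_right)
    finally show ?thesis
      by (simp add: mult.commute)
  qed simp
qed

text \<open>Both claims go through one induction on \<open>B\<close>: the bound on the enlarged span
  uses the positive distance from \<open>b\<close> to \<open>span B\<close>, which comes from
  completeness of the smaller span.\<close>

lemma finite_span_complete_bounded:
  fixes L :: "'a::real_normed_vector \<Rightarrow> 'b::real_normed_vector"
  assumes "finite B" "linear L"
  shows "complete (span B) \<and> (\<exists>C. \<forall>x\<in>span B. norm (L x) \<le> C * norm x)"
  using assms(1)
proof induction
  case empty
  then show ?case
    using linear_0[OF assms(2)] by (auto intro: compact_imp_complete exI[of _ 0])
next
  case (insert b B)
  show ?case
  proof (cases "b \<in> span B")
    case True
    then show ?thesis
      using insert.IH by (simp add: span_redundant)
  next
    case False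
    obtain d where d: "d > 0" "\<And>t w. w \<in> span B \<Longrightarrow> d * \<bar>t\<bar> \<le> norm (t *\<^sub>R b + w)"
      using norm_line_plus_complete_subspace[of "span B" b] insert.IH False by auto
    obtain C where C: "\<And>x. x \<in> span B \<Longrightarrow> norm (L x) \<le> C * norm x"
      using insert.IH by blast
    \<comment> \<open>Completeness is carried over along \<open>g\<close> from the product of the
      line and \<open>span B\<close>; for this \<open>g\<close> has to be bounded below.\<close>
    define g where "g = (\<lambda>(t::real, w). t *\<^sub>R b + w)"
    have span_eq: "span (insert b B) = g ` (UNIV \<times> span B)"
    proof
      show "span (insert b B) \<subseteq> g ` (UNIV \<times> span B)"
      proof
        fix x assume "x \<in> span (insert b B)"
        then obtain k where "x - k *\<^sub>R b \<in> span B"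
          by (auto simp: span_breakdown_eq)
        then show "x \<in> g ` (UNIV \<times> span B)"
          by (auto simp: g_def intro!: image_eqI[of _ _ "(k, x - k *\<^sub>R b)"])
      qed
      show "g ` (UNIV \<times> span B) \<subseteq> span (insert b B)"
      proof clarify
        fix t w assume "w \<in> span B"
        then show "g (t, w) \<in> span (insert b B)"
          unfolding span_breakdown_eq by (intro exI[of _ t]) (simp add: g_def)
      qed
    qed
    define M where "M = 1 + norm b"
    have w_le: "norm w \<le> norm (t *\<^sub>R b + w) + \<bar>t\<bar> * norm b" for t w
      using norm_triangle_ineq4[of "t *\<^sub>R b + w" "t *\<^sub>R b"] by simp
    have t_le: "\<bar>t\<bar> \<le> norm (t *\<^sub>R b + w) / d" if "w \<in> span B" for t w
      using d(2)[OF that, of t] d(1) by (simp add: field_simps)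
    have "complete (g ` (UNIV \<times> span B))"
    proof (rule complete_isometric_image)
      \<comment> \<open>For \<open>x = g (t, w)\<close>, the norms of \<open>t\<close> and
        \<open>w\<close> add up to at most \<open>norm x + \<bar>t\<bar> * (1 + norm b)\<close>, and
        \<open>\<bar>t\<bar> \<le> norm x / d\<close>.\<close>
      define e where "e = 1 + (1 + norm b) / d"
      have e: "e > 0"
        using d(1) by (auto simp: e_def intro!: add_pos_nonneg)
      then show "0 < 1 / e"
        by simp
      show "subspace (UNIV \<times> span B)"
        by (intro subspace_Times) auto
      show "bounded_linear g"
        unfolding g_def case_prod_beta
        by (intro bounded_linear_add bounded_linear_fst bounded_linear_snd
            bounded_linear_compose[OF bounded_linear_scaleR_left])
      show "\<forall>x\<in>UNIV \<times> span B. 1 / e * norm x \<le> norm (g x)"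
      proof clarify
        fix t :: real and w assume w: "w \<in> span B"
        have "norm (t, w) \<le> \<bar>t\<bar> + norm w"
          using norm_Pair_le[of t w] by simp
        also have "\<dots> \<le> norm (t *\<^sub>R b + w) + \<bar>t\<bar> * (1 + norm b)"
          using w_le[of w t] by (simp add: algebra_simps)
        also have "\<dots> \<le> norm (t *\<^sub>R b + w) + norm (t *\<^sub>R b + w) / d * (1 + norm b)"
          using t_le[OF w, of t] by (intro add_left_mono mult_right_mono) auto
        also have "\<dots> = e * norm (g (t, w))"
          by (simp add: e_def g_def algebra_simps add_divide_distrib)
        finally show "1 / e * norm (t, w) \<le> norm (g (t, w))"
          using e by (simp add: field_simps)
      qed
      show "complete ((UNIV::real set) \<times> span B)"
        using insert.IH by (intro complete_Times) (auto simp: complete_UNIV)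
    qed
    moreover have "norm (L x) \<le> (norm (L b) / d + \<bar>C\<bar> * (1 + norm b / d)) * norm x"
      if x: "x \<in> span (insert b B)" for x
    proof -
      obtain t w where tw: "x = t *\<^sub>R b + w" and w: "w \<in> span B"
        using x unfolding span_eq g_def by auto
      have t: "\<bar>t\<bar> \<le> norm x / d"
        using t_le[OF w] tw by simp
      have "norm w \<le> norm x + \<bar>t\<bar> * norm b"
        using w_le tw by simp
      also have "\<dots> \<le> norm x + norm x / d * norm b"
        using t by (intro add_left_mono mult_right_mono) auto
      finally have w': "norm w \<le> norm x + norm x / d * norm b" .
      have "norm (L x) \<le> \<bar>t\<bar> * norm (L b) + norm (L w)"
        unfolding tw linear_add[OF assms(2)] linear_scale[OF assms(2)]
        using norm_triangle_ineq[of "t *\<^sub>R L b" "L w"] by simp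
      \<comment> \<open>\<open>C\<close> may be negative when \<open>span B\<close> is the zero
        space, hence the absolute value.\<close>
      also have "norm (L w) \<le> \<bar>C\<bar> * norm w"
        using C[OF w] by (meson abs_ge_self mult_right_mono norm_ge_zero order_trans)
      also have "\<bar>t\<bar> * norm (L b) + \<bar>C\<bar> * norm w
          \<le> norm x / d * norm (L b) + \<bar>C\<bar> * (norm x + norm x / d * norm b)"
        using t w' by (intro add_mono mult_right_mono mult_left_mono) auto
      finally have "norm (L x) \<le> norm x / d * norm (L b) + \<bar>C\<bar> * (norm x + norm x / d * norm b)"
        by simp
      then show ?thesis
        by (simp add: algebra_simps)
    qed
    ultimately show ?thesis
      unfolding span_eq[symmetric] by blast
  qed
qed

lemma finite_dim_complete:
  assumes "finite_dim TYPE('a::real_normed_vector)"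
  shows "complete (UNIV :: 'a set)"
proof -
  obtain B :: "'a set" where "finite B" "span B = UNIV"
    using assms by (auto simp: finite_dim_def)
  then show ?thesis
    using finite_span_complete_bounded[of B "\<lambda>x. x"] linear_id by (auto simp: id_def)
qed

lemma finite_dim_bounded_linear:
  fixes L :: "'a::real_normed_vector \<Rightarrow> 'b::real_normed_vector"
  assumes "finite_dim TYPE('a)" "linear L"
  shows "bounded_linear L"
proof -
  obtain B :: "'a set" where B: "finite B" "span B = UNIV"
    using assms by (auto simp: finite_dim_def)
  then obtain C where "\<And>x. norm (L x) \<le> C * norm x"
    using finite_span_complete_bounded[OF B(1) assms(2)] by auto
  then show ?thesis
    using assms(2) by (auto simp: bounded_linear_def bounded_linear_axioms_def mult.commute)
qed

lemma blinfun_apply_Blinfun_finite_dim: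
  fixes L :: "'a::real_normed_vector \<Rightarrow> 'b::real_normed_vector"
  assumes "finite_dim TYPE('a)" "linear L"
  shows "blinfun_apply (Blinfun L) = L"
  using assms by (simp add: bounded_linear_Blinfun_apply finite_dim_bounded_linear)

text \<open>The parameter ranges over an arbitrary vector space, so the lemma iterates: once the
  innermost argument is wrapped, the result is again linear in the next one.\<close>

lemma linear_Blinfun:
  fixes F :: "'c::real_vector \<Rightarrow> 'a::real_normed_vector \<Rightarrow> 'b::real_normed_vector"
  assumes "finite_dim TYPE('a)" "\<And>x. linear (F x)" "\<And>y. linear (\<lambda>x. F x y)"
  shows "linear (\<lambda>x. Blinfun (F x))"
  using assms(2) linear_add[OF assms(3)] linear_scale[OF assms(3)]
  by (intro linearI blinfun_eqI)
     (simp_all add: blinfun_apply_Blinfun_finite_dim[OF assms(1)] blinfun.bilinear_simps)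

text \<open>The rank-one maps sending \<open>x\<close> to its \<open>b\<close>-coordinate times
  \<open>v\<close> span everything, since \<open>L\<close> is the sum of the
  \<open>R b (L b)\<close> over a basis.\<close>

lemma finite_dim_blinfun:
  assumes "finite_dim TYPE('a::real_normed_vector)" "finite_dim TYPE('b::real_normed_vector)"
  shows "finite_dim TYPE('a \<Rightarrow>\<^sub>L 'b)"
proof -
  obtain B0 :: "'a set" and C :: "'b set"
    where B0: "finite B0" "span B0 = UNIV" and C: "finite C" "span C = UNIV"
    using assms by (auto simp: finite_dim_def)
  obtain B where B: "B \<subseteq> B0" "independent B" "B0 \<subseteq> span B"
    using maximal_independent_subset[of B0] by blast
  have fB: "finite B" and sB: "span B = UNIV"
    using B B0 finite_subset span_mono[of B0 "span B"] by (auto simp: span_span)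
  define R where "R = (\<lambda>b (v::'b). Blinfun (\<lambda>x. representation B x b *\<^sub>R v))"
  have lin: "linear (\<lambda>x. representation B x b *\<^sub>R v)" for b and v :: 'b
    by (intro linearI)
       (simp_all add: representation_add[OF B(2)] representation_scale[OF B(2)] sB scaleR_add_left)
  have R: "blinfun_apply (R b v) x = representation B x b *\<^sub>R v" for b v x
    unfolding R_def blinfun_apply_Blinfun_finite_dim[OF assms(1) lin] ..
  have lR: "linear (R b)" for b
    unfolding R_def
    by (intro linear_Blinfun[OF assms(1) lin] linearI) (simp_all add: scaleR_add_right)
  define E where "E = (\<Union>b\<in>B. R b ` C)"
  have "L \<in> span E" for L
  proof -
    have "R b (L b) \<in> span E" if "b \<in> B" for b
    proof -
      have "R b (L b) \<in> R b ` span C"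
        using C by simp
      also have "\<dots> = span (R b ` C)"
        by (rule linear_span_image[OF lR, symmetric])
      also have "\<dots> \<subseteq> span E"
        using that by (intro span_mono) (auto simp: E_def)
      finally show ?thesis .
    qed
    then have "(\<Sum>b\<in>B. R b (L b)) \<in> span E"
      by (rule span_sum)
    also have "(\<Sum>b\<in>B. R b (L b)) = L"
    proof (rule blinfun_eqI)
      fix x
      have "blinfun_apply (\<Sum>b\<in>B. R b (L b)) x = L (\<Sum>b\<in>B. representation B x b *\<^sub>R b)"
        by (simp add: blinfun.bilinear_simps blinfun.sum_left blinfun.sum_right R)
      also have "(\<Sum>b\<in>B. representation B x b *\<^sub>R b) = x"
        using sB by (intro sum_representation_eq[OF B(2) _ fB]) auto
      finally show "blinfun_apply (\<Sum>b\<in>B. R b (L b)) x = L x" .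
    qed
    finally show ?thesis .
  qed
  moreover have "finite E"
    using fB C by (auto simp: E_def)
  ultimately show ?thesis
    by (auto simp: finite_dim_def)
qed

section \<open>Trilinear maps as iterated bounded linear maps\<close>

abbreviation Blinfun3 :: "('a::real_normed_vector \<Rightarrow> 'b::real_normed_vector \<Rightarrow> 'c::real_normed_vector
    \<Rightarrow> 'd::real_normed_vector) \<Rightarrow> 'a \<Rightarrow>\<^sub>L 'b \<Rightarrow>\<^sub>L 'c \<Rightarrow>\<^sub>L 'd"
  where "Blinfun3 F \<equiv> Blinfun (\<lambda>x. Blinfun (\<lambda>y. Blinfun (F x y)))"

lemma Blinfun3_apply:
  fixes F :: "'a::real_normed_vector \<Rightarrow> 'b::real_normed_vector \<Rightarrow> 'c::real_normed_vector
    \<Rightarrow> 'd::real_normed_vector"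
  assumes fd: "finite_dim TYPE('a)" "finite_dim TYPE('b)" "finite_dim TYPE('c)"
    and lin: "\<And>y z. linear (\<lambda>x. F x y z)" "\<And>x z. linear (\<lambda>y. F x y z)" "\<And>x y. linear (\<lambda>z. F x y z)"
  shows "Blinfun3 F x y z = F x y z"
  by (simp add: blinfun_apply_Blinfun_finite_dim linear_Blinfun fd lin)

lemma linear_Blinfun3:
  fixes F :: "'e::real_vector \<Rightarrow> 'a::real_normed_vector \<Rightarrow> 'b::real_normed_vector
    \<Rightarrow> 'c::real_normed_vector \<Rightarrow> 'd::real_normed_vector"
  assumes fd: "finite_dim TYPE('a)" "finite_dim TYPE('b)" "finite_dim TYPE('c)"
    and lin: "\<And>u y z. linear (\<lambda>x. F u x y z)" "\<And>u x z. linear (\<lambda>y. F u x y z)"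
      "\<And>u x y. linear (\<lambda>z. F u x y z)"
    and lin0: "\<And>x y z. linear (\<lambda>u. F u x y z)"
  shows "linear (\<lambda>u. Blinfun3 (F u))"
  by (intro linear_Blinfun fd lin lin0)

section \<open>Perturbing a zero along an exact sequence\<close>

text \<open>The constant \<open>e\<close> depends only on \<open>D\<close>, \<open>K\<close> and
  \<open>A\<close>, not on \<open>r\<close> or \<open>\<Phi>\<close>, so neighborhoods can be fitted
  to it afterwards. The last premise on \<open>\<Phi>\<close> replaces surjectivity of
  \<open>D\<close> onto \<open>A\<close>: it forces a point where the projected equation holds to be
  a true zero.\<close>

lemma exact_perturbed_zero:
  fixes D :: "'x::real_normed_vector \<Rightarrow> 'y::real_normed_vector"
    and K :: "'y \<Rightarrow> 'z::real_normed_vector"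
  assumes fd: "finite_dim TYPE('y)" "finite_dim TYPE('z)"
    and D: "linear D" and K: "linear K" and A: "subspace A"
    and exact: "\<And>y. y \<in> A \<Longrightarrow> K y = 0 \<Longrightarrow> y \<in> range D"
  obtains e where "e > 0"
    and "\<And>r \<Phi>. 0 < r \<Longrightarrow> (\<And>u. norm u \<le> r \<Longrightarrow> \<Phi> u \<in> A)
      \<Longrightarrow> (\<And>u v. norm u \<le> r \<Longrightarrow> norm v \<le> r \<Longrightarrow> norm (\<Phi> u - \<Phi> v - D (u - v)) \<le> e * norm (u - v))
      \<Longrightarrow> norm (\<Phi> 0) \<le> e * r
      \<Longrightarrow> (\<And>u. norm u \<le> r \<Longrightarrow> norm (K (\<Phi> u)) \<le> e * norm (\<Phi> u))
      \<Longrightarrow> \<exists>u. norm u \<le> r \<and> \<Phi> u = 0"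
proof -
  obtain S where S: "linear S" "\<And>x. D (S (D x)) = D x"
    using linear_exists_right_inverse_on[OF D subspace_UNIV] by auto
  obtain R where R: "linear R" "range R \<subseteq> A" "\<And>y. y \<in> A \<Longrightarrow> K (R (K y)) = K y"
    using linear_exists_right_inverse_on[OF K A] by auto
  \<comment> \<open>\<open>P\<close> projects onto the range of \<open>D\<close>, and
    \<open>T\<close> is \<open>R\<close> followed by the complementary projection.\<close>
  define P where "P = (\<lambda>y. D (S y))"
  define T where "T = (\<lambda>z. R z - P (R z))"
  have P: "linear P"
    using linear_compose[OF S(1) D] by (simp add: P_def o_def)
  have T: "linear T"
    unfolding T_def using linear_compose_sub[OF R(1) linear_compose[OF R(1) P]] by (simp add: o_def)
  have homotopy: "P y + T (K y) = y" if "y \<in> A" for y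
  proof -
    \<comment> \<open>Subtracting \<open>R (K y)\<close> moves \<open>y\<close> into the kernel of
      \<open>K\<close> without leaving \<open>A\<close>; exactness then applies and \<open>P\<close>
      fixes the difference.\<close>
    have "y - R (K y) \<in> range D"
    proof (rule exact)
      show "y - R (K y) \<in> A"
        using that R(2) A by (intro subspace_diff) auto
      show "K (y - R (K y)) = 0"
        using R(3)[OF that] by (simp add: linear_diff[OF K])
    qed
    then have "P (y - R (K y)) = y - R (K y)"
      using S(2) by (auto simp: P_def)
    then show ?thesis
      by (simp add: T_def linear_diff[OF P] algebra_simps)
  qed
  obtain p where p: "p > 0" "\<And>y. norm (P y) \<le> norm y * p"
    using bounded_linear.pos_bounded[OF finite_dim_bounded_linear[OF fd(1) P]] by blast
  obtain s where s: "s > 0" "\<And>y. norm (S y) \<le> norm y * s"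
    using bounded_linear.pos_bounded[OF finite_dim_bounded_linear[OF fd(1) S(1)]] by blast
  obtain t where t: "t > 0" "\<And>y. norm (T y) \<le> norm y * t"
    using bounded_linear.pos_bounded[OF finite_dim_bounded_linear[OF fd(2) T]] by blast
  \<comment> \<open>The first bound makes \<open>G\<close> below a contraction with factor 1/2, the
    second makes \<open>T (K (\<Phi> u))\<close> at most half as large as
    \<open>\<Phi> u\<close>.\<close>
  define e where "e = min (1 / (2 * p * s)) (1 / (2 * t))"
  have e: "e > 0" "e * p * s \<le> 1 / 2" "e * t \<le> 1 / 2"
  proof -
    show "e > 0"
      using p s t by (simp add: e_def)
    have "e \<le> 1 / (2 * p * s)" "e \<le> 1 / (2 * t)"
      by (simp_all add: e_def)
    then show "e * p * s \<le> 1 / 2" "e * t \<le> 1 / 2"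
      using p s t by (simp_all add: field_simps)
  qed
  show thesis
  proof (rule that[OF e(1)])
    fix r :: real and \<Phi> :: "'x \<Rightarrow> 'y"
    assume r: "0 < r" and \<Phi>A: "\<And>u. norm u \<le> r \<Longrightarrow> \<Phi> u \<in> A"
      and \<Phi>: "\<And>u v. norm u \<le> r \<Longrightarrow> norm v \<le> r \<Longrightarrow> norm (\<Phi> u - \<Phi> v - D (u - v)) \<le> e * norm (u - v)"
      and \<Phi>0: "norm (\<Phi> 0) \<le> e * r"
      and K\<Phi>: "\<And>u. norm u \<le> r \<Longrightarrow> norm (K (\<Phi> u)) \<le> e * norm (\<Phi> u)"
    \<comment> \<open>The iteration runs in the target space, which is complete. The radius is
      chosen so that \<open>S\<close> maps \<open>B\<close> into the ball of radius
      \<open>r\<close>, and a fixed point of \<open>G\<close> satisfies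
      \<open>P (\<Phi> (S w)) = 0\<close>.\<close>
    define B where "B = cball (0::'y) (r / s)"
    define G where "G = (\<lambda>w. P (w - \<Phi> (S w)))"
    have S_le: "norm (S w) \<le> r" if "w \<in> B" for w
      using s(2)[of w] mult_right_mono[of "norm w" "r / s" s] that s(1) by (simp add: B_def)
    have lip: "dist (G w) (G w') \<le> 1 / 2 * dist w w'" if "w \<in> B" "w' \<in> B" for w w'
    proof -
      \<comment> \<open>This cancels the linear part of \<open>\<Phi>\<close> against the identity
        part of \<open>G\<close>, leaving only the error controlled by \<open>e\<close>.\<close>
      have "P (D (S y)) = P y" for y
        by (simp add: P_def S(2))
      then have "G w - G w' = - P (\<Phi> (S w) - \<Phi> (S w') - D (S w - S w'))"
        by (simp add: G_def linear_diff[OF P] linear_diff[OF S(1)] linear_diff[OF D])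
      then have "norm (G w - G w') \<le> norm (\<Phi> (S w) - \<Phi> (S w') - D (S w - S w')) * p"
        using p(2) by simp
      also have "\<dots> \<le> e * norm (S w - S w') * p"
        using \<Phi>[OF S_le S_le, OF that] p(1) by (intro mult_right_mono) auto
      also have "\<dots> \<le> e * (norm (w - w') * s) * p"
        using s(2)[of "w - w'"] e(1) p(1)
        by (intro mult_right_mono mult_left_mono) (auto simp: linear_diff[OF S(1)])
      also have "\<dots> = (e * p * s) * norm (w - w')"
        by simp
      also have "\<dots> \<le> 1 / 2 * norm (w - w')"
        using e(2) by (intro mult_right_mono) auto
      finally show ?thesis
        by (simp add: dist_norm)
    qed
    have zero: "0 \<in> B"
      using r s(1) by (simp add: B_def)
    \<comment> \<open>The image of the center uses up half the radius and the contraction factor the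
      other half, so \<open>G\<close> maps \<open>B\<close> to itself.\<close>
    have "norm (G 0) \<le> r / s / 2"
    proof -
      have "norm (G 0) = norm (P (\<Phi> 0))"
        by (simp add: G_def linear_0[OF S(1)] linear_neg[OF P])
      also have "\<dots> \<le> norm (\<Phi> 0) * p"
        by (rule p(2))
      also have "\<dots> \<le> e * r * p"
        using \<Phi>0 p(1) by (intro mult_right_mono) auto
      also have "\<dots> = (e * p * s) * (r / s)"
        using s(1) by simp
      also have "\<dots> \<le> 1 / 2 * (r / s)"
        using e(2) r s(1) by (intro mult_right_mono) auto
      finally show ?thesis
        by simp
    qed
    then have "G w \<in> B" if "w \<in> B" for w
      using lip[OF that zero] that norm_triangle_ineq2[of "G w" "G 0"]
      by (simp add: B_def dist_norm)
    moreover have "complete B"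
      unfolding B_def
      using complete_Int_closed[OF finite_dim_complete[OF fd(1)] closed_cball] by simp
    ultimately obtain w where w: "w \<in> B" "G w = w"
      using Banach_fix[of B "1/2" G] lip zero by auto
    \<comment> \<open>A fixed point is a value of \<open>P\<close>, hence lies in the range of
      \<open>D\<close>.\<close>
    have "P w = w"
      using w(2) by (metis G_def P_def S(2))
    then have "P (\<Phi> (S w)) = 0"
      using w(2) by (simp add: G_def linear_diff[OF P])
    then have "norm (\<Phi> (S w)) = norm (T (K (\<Phi> (S w))))"
      using homotopy[OF \<Phi>A[OF S_le[OF w(1)]]] by simp
    also have "\<dots> \<le> e * norm (\<Phi> (S w)) * t"
      using t order_trans[OF t(2) mult_right_mono[OF K\<Phi>[OF S_le[OF w(1)]]]] by simp
    also have "\<dots> \<le> 1 / 2 * norm (\<Phi> (S w))"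
      using mult_right_mono[OF e(3), of "norm (\<Phi> (S w))"] by (simp add: mult_ac)
    finally have "\<Phi> (S w) = 0"
      by simp
    then show "\<exists>u. norm u \<le> r \<and> \<Phi> u = 0"
      using S_le[OF w(1)] by blast
  qed
qed

section \<open>The deformation complex of a morphism in low degrees\<close>

definition alternating_maps :: "('g::real_normed_vector \<Rightarrow>\<^sub>L 'g \<Rightarrow>\<^sub>L 'g \<Rightarrow>\<^sub>L 'h::real_normed_vector) set"
  where "alternating_maps = {\<theta> :: 'g \<Rightarrow>\<^sub>L 'g \<Rightarrow>\<^sub>L 'g \<Rightarrow>\<^sub>L 'h. \<forall>x y. \<theta> x x y = 0 \<and> \<theta> x y y = 0 \<and> \<theta> x y x = 0}"

definition morphism_defect ::
    "'g::real_normed_vector trilin \<Rightarrow> 'h::real_normed_vector trilin \<Rightarrow> ('g \<Rightarrow>\<^sub>L 'h) \<Rightarrow>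
      'g \<Rightarrow>\<^sub>L 'g \<Rightarrow>\<^sub>L 'g \<Rightarrow>\<^sub>L 'h"
  where "morphism_defect p m f =
    Blinfun3 (\<lambda>x y z. f (app3 p x y z) - app3 m (f x) (f y) (f z))"

text \<open>The part of \<open>morphism_defect p m (f + u)\<close> that is linear in
  \<open>u\<close>.\<close>

definition d1 ::
    "'g::real_normed_vector trilin \<Rightarrow> 'h::real_normed_vector trilin \<Rightarrow> ('g \<Rightarrow>\<^sub>L 'h) \<Rightarrow>
      ('g \<Rightarrow>\<^sub>L 'h) \<Rightarrow> 'g \<Rightarrow>\<^sub>L 'g \<Rightarrow>\<^sub>L 'g \<Rightarrow>\<^sub>L 'h"
  where "d1 p m f u = Blinfun3 (\<lambda>x y z. u (app3 p x y z)
    - app3 m (u x) (f y) (f z) - app3 m (f x) (u y) (f z) - app3 m (f x) (f y) (u z))"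

text \<open>The degree 2 coboundary at \<open>x1 \<and> y1\<close>, \<open>x2 \<and> y2\<close>,
  \<open>z\<close>: the terms through \<open>p\<close> come first, those through \<open>m\<close>
  are bracketed. It is a plain function so that linearity in each slot can be shown before
  wrapping.\<close>

definition d2_fun ::
    "'g::real_normed_vector trilin \<Rightarrow> 'h::real_normed_vector trilin \<Rightarrow> ('g \<Rightarrow>\<^sub>L 'h) \<Rightarrow>
      ('g \<Rightarrow>\<^sub>L 'g \<Rightarrow>\<^sub>L 'g \<Rightarrow>\<^sub>L 'h) \<Rightarrow> 'g \<Rightarrow> 'g \<Rightarrow> 'g \<Rightarrow> 'g \<Rightarrow> 'g \<Rightarrow> 'h"
  where "d2_fun p m f \<theta> x1 y1 x2 y2 z =
      \<theta> x1 y1 (app3 p x2 y2 z) - \<theta> (app3 p x1 y1 x2) y2 z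
    - \<theta> x2 (app3 p x1 y1 y2) z - \<theta> x2 y2 (app3 p x1 y1 z)
    + (app3 m (f x1) (f y1) (\<theta> x2 y2 z) - app3 m (f x2) (f y2) (\<theta> x1 y1 z)
    - app3 m (\<theta> x1 y1 x2) (f y2) (f z) - app3 m (f x2) (\<theta> x1 y1 y2) (f z))"

definition d2 ::
    "'g::real_normed_vector trilin \<Rightarrow> 'h::real_normed_vector trilin \<Rightarrow> ('g \<Rightarrow>\<^sub>L 'h) \<Rightarrow>
      ('g \<Rightarrow>\<^sub>L 'g \<Rightarrow>\<^sub>L 'g \<Rightarrow>\<^sub>L 'h) \<Rightarrow> 'g \<Rightarrow>\<^sub>L 'g \<Rightarrow>\<^sub>L 'g \<Rightarrow>\<^sub>L 'g \<Rightarrow>\<^sub>L 'g \<Rightarrow>\<^sub>L 'h"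
  where "d2 p m f \<theta> = Blinfun (\<lambda>x1. Blinfun (\<lambda>y1. Blinfun3 (d2_fun p m f \<theta> x1 y1)))"

lemma subspace_alternating_maps: "subspace alternating_maps"
  by (auto simp: subspace_def alternating_maps_def blinfun.bilinear_simps)

context
  assumes fd: "finite_dim TYPE('g::real_normed_vector)"
begin

lemma morphism_defect_apply:
  fixes p :: "'g trilin"
  shows "morphism_defect p m f x y z = f (app3 p x y z) - app3 m (f x) (f y) (f z)"
  unfolding morphism_defect_def
  by (intro Blinfun3_apply fd linearI) (simp_all add: blinfun.bilinear_simps algebra_simps)

lemma d1_apply:
  fixes p :: "'g trilin"
  shows "d1 p m f u x y z = u (app3 p x y z)
    - app3 m (u x) (f y) (f z) - app3 m (f x) (u y) (f z) - app3 m (f x) (f y) (u z)"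
  unfolding d1_def
  by (intro Blinfun3_apply fd linearI) (simp_all add: blinfun.bilinear_simps algebra_simps)

lemma linear_d1: "linear (d1 (p :: 'g trilin) m f)"
  by (intro linearI blinfun_eqI)
     (simp_all add: blinfun.bilinear_simps d1_apply algebra_simps)

lemma linear_d2_fun:
  fixes p :: "'g trilin"
  shows "linear (\<lambda>x1. d2_fun p m f \<theta> x1 y1 x2 y2 z)"
    "linear (\<lambda>y1. d2_fun p m f \<theta> x1 y1 x2 y2 z)"
    "linear (\<lambda>x2. d2_fun p m f \<theta> x1 y1 x2 y2 z)"
    "linear (\<lambda>y2. d2_fun p m f \<theta> x1 y1 x2 y2 z)"
    "linear (\<lambda>z. d2_fun p m f \<theta> x1 y1 x2 y2 z)"
    "linear (\<lambda>\<theta>. d2_fun p m f \<theta> x1 y1 x2 y2 z)"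
  by (intro linearI; simp add: d2_fun_def blinfun.bilinear_simps algebra_simps)+

lemma d2_apply:
  fixes p :: "'g trilin"
  shows "d2 p m f \<theta> x1 y1 x2 y2 z = d2_fun p m f \<theta> x1 y1 x2 y2 z"
  unfolding d2_def
  by (simp add: blinfun_apply_Blinfun_finite_dim linear_Blinfun linear_Blinfun3 fd linear_d2_fun)

lemma linear_d2: "linear (d2 (p :: 'g trilin) m f)"
  unfolding d2_def
  by (intro linear_Blinfun linear_Blinfun3 fd linear_d2_fun)

lemma morphism_defect_alternating:
  fixes p :: "'g trilin"
  assumes "p \<in> alternating3" "m \<in> alternating3"
  shows "morphism_defect p m f \<in> alternating_maps"
  using assms
  by (simp add: alternating_maps_def alternating3_def morphism_defect_apply blinfun.bilinear_simps)

text \<open>Here \<open>f\<close> is any linear map. The terms with two brackets of \<open>p\<close>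
  cancel by the identity of \<open>p\<close>, those with two brackets of \<open>m\<close> by that of
  \<open>m\<close>, and the mixed terms cancel in pairs.\<close>

lemma d2_morphism_defect:
  fixes p :: "'g trilin"
  assumes p: "three_lie_structure p" and m: "three_lie_structure m"
  shows "d2_fun p m f (morphism_defect p m f) x1 y1 x2 y2 z = 0"
proof -
  have *: "app3 p x1 y1 (app3 p x2 y2 z) = app3 p (app3 p x1 y1 x2) y2 z
       + app3 p x2 (app3 p x1 y1 y2) z + app3 p x2 y2 (app3 p x1 y1 z)"
    using p unfolding three_lie_structure_def by blast
  have "app3 m (f x1) (f y1) (app3 m (f x2) (f y2) (f z)) = app3 m (app3 m (f x1) (f y1) (f x2)) (f y2) (f z)
       + app3 m (f x2) (app3 m (f x1) (f y1) (f y2)) (f z) + app3 m (f x2) (f y2) (app3 m (f x1) (f y1) (f z))"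
    using m unfolding three_lie_structure_def by blast
  then show ?thesis
    by (simp add: d2_fun_def morphism_defect_apply blinfun.bilinear_simps *)
qed

text \<open>Translates the vanishing of cohomology, stated for cochains on lists, into the exactness
  premise of \<open>exact_perturbed_zero\<close>.\<close>

lemma d2_kernel_in_d1_range:
  fixes p :: "'g trilin"
  assumes H: "cohomology2 p m f = {coboundaries2 p m f}"
    and alt: "\<theta> \<in> alternating_maps" and ker: "d2 p m f \<theta> = 0"
  shows "\<theta> \<in> range (d1 p m f)"
proof -
  \<comment> \<open>The list form of \<open>\<theta>\<close>; the value 0 on other lengths is what
    \<open>cochains\<close> requires.\<close>
  define \<theta>' where "\<theta>' = (\<lambda>Xs z. if length Xs = 1 then \<theta> (fst (Xs ! 0)) (snd (Xs ! 0)) z else 0)"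
  have ker': "d2_fun p m f \<theta> x1 y1 x2 y2 z = 0" for x1 y1 x2 y2 z
    using ker d2_apply[of p m f \<theta> x1 y1 x2 y2 z] by simp
  have "\<theta>' \<in> cochains 2"
    using alt
    by (auto simp: cochains_def \<theta>'_def alternating_maps_def length_Suc_conv blinfun.bilinear_simps
        intro!: linearI)
  moreover have "coboundary p m f 2 \<theta>' Xs z = 0" for Xs z
  proof (cases "length Xs = 2")
    case True
    then obtain x1 y1 x2 y2 where Xs: "Xs = [(x1, y1), (x2, y2)]"
      by (auto simp: numeral_2_eq_2 length_Suc_conv)
    have sets: "{Suc 0..2} = {1, 2}" "{Suc 0..<2} = {1}"
      by auto
    have "coboundary p m f 2 \<theta>' Xs z = d2_fun p m f \<theta> x1 y1 x2 y2 z"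
      by (simp add: coboundary_def Let_def Xs sets omit_def \<theta>'_def d2_fun_def algebra_simps)
    then show ?thesis
      using ker' by simp
  qed (simp add: coboundary_def)
  ultimately have "\<theta>' \<in> cocycles2 p m f"
    by (auto simp: cocycles2_def)
  \<comment> \<open>There is only one coset, so the coset of \<open>\<theta>'\<close> is
    \<open>coboundaries2 p m f\<close> itself; it contains \<open>\<theta>'\<close> because 0 is a
    coboundary.\<close>
  then have eq: "(\<lambda>\<beta> Xs x. \<theta>' Xs x + \<beta> Xs x) ` coboundaries2 p m f = coboundaries2 p m f"
    using imageI[of \<theta>' "cocycles2 p m f" "\<lambda>\<theta>. (\<lambda>\<beta> Xs x. \<theta> Xs x + \<beta> Xs x) ` coboundaries2 p m f"]
    unfolding H[unfolded cohomology2_def] by simp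
  have "(\<lambda>Xs x. 0) \<in> coboundaries2 p m f"
    unfolding coboundaries2_def
    by (rule image_eqI[of _ _ "\<lambda>Xs x. 0"])
       (auto simp: coboundary_def cochains_def fun_eq_iff Let_def blinfun.bilinear_simps intro!: linearI)
  then have "(\<lambda>Xs x. \<theta>' Xs x + 0) \<in> coboundaries2 p m f"
    by (subst eq[symmetric]) (rule imageI)
  then obtain c where c: "c \<in> cochains 1" "\<theta>' = coboundary p m f 1 c"
    by (auto simp: coboundaries2_def)
  \<comment> \<open>\<^const>\<open>d1\<close> is minus the coboundary of degree 1.\<close>
  have lin: "linear (\<lambda>x. - c [] x)"
    using c(1) by (auto simp: cochains_def intro!: linear_compose_neg)
  have "\<theta> x y z = d1 p m f (Blinfun (\<lambda>x. - c [] x)) x y z" for x y z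
  proof -
    have "\<theta> x y z = \<theta>' [(x, y)] z"
      by (simp add: \<theta>'_def)
    also have "\<dots> = d1 p m f (Blinfun (\<lambda>x. - c [] x)) x y z"
      by (simp add: c(2) coboundary_def Let_def omit_def d1_apply blinfun_apply_Blinfun_finite_dim[OF fd lin]
          blinfun.bilinear_simps algebra_simps)
    finally show ?thesis .
  qed
  then show ?thesis
    by (intro image_eqI[of _ _ "Blinfun (\<lambda>x. - c [] x)"] blinfun_eqI) auto
qed

end

section \<open>Continuity estimates\<close>

lemma norm_app3_le:
  fixes q :: "'h::real_normed_vector trilin"
  assumes "norm q \<le> Q" "norm x \<le> X" "norm y \<le> Y" "norm z \<le> Z"
  shows "norm (app3 q x y z) \<le> Q * X * Y * Z"
proof -
  have nonneg: "0 \<le> Q" "0 \<le> X" "0 \<le> Y"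
    using assms norm_ge_zero order_trans by blast+
  have "norm (app3 q x y z) \<le> norm (q x y) * norm z"
    by (rule norm_blinfun)
  also have "norm (q x y) \<le> norm (q x) * norm y"
    by (rule norm_blinfun)
  also have "norm (q x) \<le> norm q * norm x"
    by (rule norm_blinfun)
  also have "norm q * norm x * norm y * norm z \<le> Q * X * Y * Z"
    using assms nonneg by (intro mult_mono) auto
  finally show ?thesis
    by (simp add: mult_right_mono)
qed

text \<open>Telescoping: first the bracket changes, then one argument at a time. The scales
  \<open>\<alpha>\<close>, \<open>\<beta>\<close>, \<open>\<gamma>\<close> allow an argument to be a
  vector image or a cochain value.\<close>

lemma app3_diff_le:
  fixes m w :: "'h::real_normed_vector trilin"
  assumes "norm (w - m) \<le> \<rho>"
    and a: "norm a \<le> M * \<alpha>" "norm a' \<le> M * \<alpha>" "norm (a' - a) \<le> \<rho> * \<alpha>"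
    and b: "norm b \<le> M * \<beta>" "norm b' \<le> M * \<beta>" "norm (b' - b) \<le> \<rho> * \<beta>"
    and c: "norm c' \<le> M * \<gamma>" "norm (c' - c) \<le> \<rho> * \<gamma>"
  shows "norm (app3 w a' b' c' - app3 m a b c) \<le> (M ^ 3 + 3 * norm m * M ^ 2) * \<rho> * (\<alpha> * \<beta> * \<gamma>)"
proof -
  have "app3 w a' b' c' - app3 m a b c = app3 (w - m) a' b' c' + app3 m (a' - a) b' c'
      + app3 m a (b' - b) c' + app3 m a b (c' - c)"
    by (simp add: blinfun.bilinear_simps)
  also have "norm \<dots> \<le> norm (app3 (w - m) a' b' c') + norm (app3 m (a' - a) b' c')
      + norm (app3 m a (b' - b) c') + norm (app3 m a b (c' - c))"
    by (intro norm_triangle_le add_right_mono order_refl)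
  also have "\<dots> \<le> \<rho> * (M * \<alpha>) * (M * \<beta>) * (M * \<gamma>) + norm m * (\<rho> * \<alpha>) * (M * \<beta>) * (M * \<gamma>)
      + norm m * (M * \<alpha>) * (\<rho> * \<beta>) * (M * \<gamma>) + norm m * (M * \<alpha>) * (M * \<beta>) * (\<rho> * \<gamma>)"
    using assms by (intro add_mono norm_app3_le) auto
  also have "\<dots> = (M ^ 3 + 3 * norm m * M ^ 2) * \<rho> * (\<alpha> * \<beta> * \<gamma>)"
    by (simp add: algebra_simps power2_eq_square power3_eq_cube)
  finally show ?thesis .
qed

lemma norm_blinfun3_bound:
  fixes L :: "'a::real_normed_vector \<Rightarrow>\<^sub>L 'b::real_normed_vector \<Rightarrow>\<^sub>L 'c::real_normed_vector
    \<Rightarrow>\<^sub>L 'd::real_normed_vector"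
  assumes "0 \<le> C" "\<And>x y z. norm (L x y z) \<le> C * (norm x * norm y * norm z)"
  shows "norm L \<le> C"
  using assms by (intro norm_blinfun_bound) (auto simp: mult.assoc)

section \<open>Stability from the vanishing of the second cohomology\<close>

theorem theorem4p11:
  fixes \<pi> :: "'g::real_normed_vector trilin"
    and \<mu> :: "'h::real_normed_vector trilin"
    and f :: "'g \<Rightarrow>\<^sub>L 'h"
  assumes "\<exists>B::'g set. finite B \<and> span B = UNIV"
    and "\<exists>B::'h set. finite B \<and> span B = UNIV"
    and "three_lie_structure \<pi>"
    and "three_lie_structure \<mu>"
    and "three_lie_morphism \<pi> \<mu> f"
    and "cohomology2 \<pi> \<mu> f = {coboundaries2 \<pi> \<mu> f}"
  shows "stable_morphism \<pi> \<mu> f"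
  unfolding stable_morphism_def
proof (intro allI impI, elim conjE)
  fix V assume V: "open V" "f \<in> V"
  have fd: "finite_dim TYPE('g)" "finite_dim TYPE('h)"
    using assms(1,2) by (auto simp: finite_dim_def)
  have fdY: "finite_dim TYPE('g \<Rightarrow>\<^sub>L 'g \<Rightarrow>\<^sub>L 'g \<Rightarrow>\<^sub>L 'h)"
    and fdZ: "finite_dim TYPE('g \<Rightarrow>\<^sub>L 'g \<Rightarrow>\<^sub>L 'g \<Rightarrow>\<^sub>L 'g \<Rightarrow>\<^sub>L 'g \<Rightarrow>\<^sub>L 'h)"
    by (intro finite_dim_blinfun fd)+
  note simps = morphism_defect_apply[OF fd(1)] d1_apply[OF fd(1)]
  obtain e where e: "e > 0"
    and zero: "\<And>r \<Phi>. 0 < r \<Longrightarrow> (\<And>u. norm u \<le> r \<Longrightarrow> \<Phi> u \<in> alternating_maps)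
      \<Longrightarrow> (\<And>u v. norm u \<le> r \<Longrightarrow> norm v \<le> r \<Longrightarrow> norm (\<Phi> u - \<Phi> v - d1 \<pi> \<mu> f (u - v)) \<le> e * norm (u - v))
      \<Longrightarrow> norm (\<Phi> 0) \<le> e * r
      \<Longrightarrow> (\<And>u. norm u \<le> r \<Longrightarrow> norm (d2 \<pi> \<mu> f (\<Phi> u)) \<le> e * norm (\<Phi> u))
      \<Longrightarrow> \<exists>u. norm u \<le> r \<and> \<Phi> u = 0"
    by (rule exact_perturbed_zero[where D = "d1 \<pi> \<mu> f" and K = "d2 \<pi> \<mu> f", OF fdY fdZ
          linear_d1[OF fd(1)] linear_d2[OF fd(1)] subspace_alternating_maps
          d2_kernel_in_d1_range[OF fd(1) assms(6)]]) auto
  \<comment> \<open>\<open>M\<close> bounds both \<open>f\<close> and \<open>f + u\<close> for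
    \<open>norm u \<le> 1\<close>; \<open>c\<close> is the constant of
    \<open>app3_diff_le\<close>.\<close>
  define M where "M = norm f + 1"
  define c where "c = M ^ 3 + 3 * norm \<mu> * M ^ 2"
  have M: "M \<ge> 1" "norm f \<le> M"
    by (simp_all add: M_def)
  then have c: "c > 0"
    by (auto simp: c_def intro!: add_pos_nonneg)
  \<comment> \<open>The factor 4 counts the bracket terms of \<open>d2\<close>; the derivative
    estimate has only three.\<close>
  define \<rho> where "\<rho> = min 1 (e / (4 * c))"
  have \<rho>: "0 < \<rho>" "\<rho> \<le> 1" "4 * (c * \<rho>) \<le> e"
  proof -
    have "\<rho> \<le> e / (4 * c)"
      by (simp add: \<rho>_def)
    then show "4 * (c * \<rho>) \<le> e"
      using c by (simp add: field_simps)
  qed (use e c in \<open>auto simp: \<rho>_def\<close>)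
  obtain r0 where r0: "r0 > 0" "cball f r0 \<subseteq> V"
    using V open_contains_cball by blast
  define r where "r = min \<rho> r0"
  have r: "0 < r" "r \<le> \<rho>" "r \<le> r0"
    using \<rho> r0 by (auto simp: r_def)
  \<comment> \<open>The second bound makes the defect of \<open>f\<close> itself at most
    \<open>e * r\<close>.\<close>
  define \<delta> where "\<delta> = min \<rho> (e * r / c)"
  have \<delta>: "0 < \<delta>" "\<delta> \<le> \<rho>" "c * \<delta> \<le> e * r"
  proof -
    have "\<delta> \<le> e * r / c"
      by (simp add: \<delta>_def)
    then show "c * \<delta> \<le> e * r"
      using c by (simp add: field_simps)
  qed (use e c \<rho> r in \<open>auto simp: \<delta>_def\<close>)
  have ex: "\<exists>f'\<in>V. three_lie_morphism \<pi> w f'"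
    if w: "three_lie_structure w" and close: "norm (w - \<mu>) \<le> \<delta>" for w
  proof -
    define \<Phi> where "\<Phi> = (\<lambda>u. morphism_defect \<pi> w (f + u))"
    have w\<rho>: "norm (w - \<mu>) \<le> \<rho>"
      using close \<delta> by simp
    have f_le: "norm (f x) \<le> M * norm x" for x
      using norm_blinfun[of f x] M mult_right_mono[of "norm f" M "norm x"] by simp
    have u_le: "norm (u x) \<le> \<rho> * norm x" if "norm u \<le> r" for u :: "'g \<Rightarrow>\<^sub>L 'h" and x
      using norm_blinfun[of u x] that r mult_right_mono[of "norm u" \<rho> "norm x"] by simp
    have fu_le: "norm ((f + u) x) \<le> M * norm x" if "norm u \<le> r" for u x
    proof -
      have "norm (f + u) \<le> M"
        using that r \<rho> norm_triangle_ineq[of f u] by (simp add: M_def)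
      then show ?thesis
        using norm_blinfun[of "f + u" x] mult_right_mono[of "norm (f + u)" M "norm x"] by simp
    qed
    have fu_diff: "norm ((f + u) x - f x) \<le> \<rho> * norm x" if "norm u \<le> r" for u x
      using u_le[OF that] by (simp add: blinfun.bilinear_simps)
    \<comment> \<open>Covers an argument that is the same in both brackets; \<open>M \<ge> 1\<close>
      fits it to the premises of \<open>app3_diff_le\<close>.\<close>
    have same: "norm a \<le> M * B" "norm (a - a) \<le> \<rho> * B" if "norm a \<le> B" for a :: 'h and B
    proof -
      have "0 \<le> B"
        using that norm_ge_zero order_trans by blast
      then show "norm a \<le> M * B" "norm (a - a) \<le> \<rho> * B"
        using that M \<rho> mult_right_mono[of 1 M B] by auto
    qed
    note diff = app3_diff_le[OF w\<rho>, of _ M, folded c_def]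
    have "\<exists>u. norm u \<le> r \<and> \<Phi> u = 0"
    proof (rule zero[OF r(1)])
      fix u :: "'g \<Rightarrow>\<^sub>L 'h" assume "norm u \<le> r"
      show "\<Phi> u \<in> alternating_maps"
        unfolding \<Phi>_def using assms(3) w
        by (intro morphism_defect_alternating fd) (simp_all only: three_lie_structure_def)
    next
      fix u v :: "'g \<Rightarrow>\<^sub>L 'h" assume u: "norm u \<le> r" and v: "norm v \<le> r"
      have "norm (\<Phi> u - \<Phi> v - d1 \<pi> \<mu> f (u - v)) \<le> 3 * (c * \<rho>) * norm (u - v)"
      proof (rule norm_blinfun3_bound)
        fix x y z
        define h where "h = u - v"
        \<comment> \<open>Passing from \<open>f + v\<close> to \<open>f + u\<close> one slot at a
          time puts \<open>h\<close> into a single slot of each term; the terms through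
          \<open>\<pi>\<close> cancel against those of \<open>d1\<close>.\<close>
        have "(\<Phi> u - \<Phi> v - d1 \<pi> \<mu> f (u - v)) x y z =
            - ((app3 w (h x) ((f + u) y) ((f + u) z) - app3 \<mu> (h x) (f y) (f z))
             + (app3 w ((f + v) x) (h y) ((f + u) z) - app3 \<mu> (f x) (h y) (f z))
             + (app3 w ((f + v) x) ((f + v) y) (h z) - app3 \<mu> (f x) (f y) (h z)))"
          by (simp add: \<Phi>_def simps h_def blinfun.bilinear_simps)
        then have "norm ((\<Phi> u - \<Phi> v - d1 \<pi> \<mu> f (u - v)) x y z) \<le> norm (app3 w (h x) ((f + u) y) ((f + u) z) - app3 \<mu> (h x) (f y) (f z))
             + norm (app3 w ((f + v) x) (h y) ((f + u) z) - app3 \<mu> (f x) (h y) (f z))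
             + norm (app3 w ((f + v) x) ((f + v) y) (h z) - app3 \<mu> (f x) (f y) (h z))"
          by (simp only: norm_minus_cancel) (intro norm_triangle_le add_right_mono order_refl)
        also have "\<dots> \<le> c * \<rho> * ((norm h * norm x) * norm y * norm z)
             + c * \<rho> * (norm x * (norm h * norm y) * norm z)
             + c * \<rho> * (norm x * norm y * (norm h * norm z))"
          by (intro add_mono diff same[OF norm_blinfun[of h]] f_le fu_le fu_diff u v)
        also have "\<dots> = 3 * (c * \<rho>) * norm (u - v) * (norm x * norm y * norm z)"
          by (simp add: h_def)
        finally show "norm ((\<Phi> u - \<Phi> v - d1 \<pi> \<mu> f (u - v)) x y z)
            \<le> 3 * (c * \<rho>) * norm (u - v) * (norm x * norm y * norm z)" .
      qed (use c \<rho> in simp)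
      also have "\<dots> \<le> e * norm (u - v)"
      proof (rule mult_right_mono)
        show "3 * (c * \<rho>) \<le> e"
          using \<rho>(3) mult_pos_pos[OF c \<rho>(1)] by linarith
      qed simp
      finally show "norm (\<Phi> u - \<Phi> v - d1 \<pi> \<mu> f (u - v)) \<le> e * norm (u - v)" .
    next
      have "norm (\<Phi> 0) \<le> c * \<delta>"
      proof (rule norm_blinfun3_bound)
        fix x y z
        \<comment> \<open>Since \<open>f\<close> is a morphism to \<open>\<mu>\<close>, only the
          difference of the two brackets remains.\<close>
        have "\<Phi> 0 x y z = - (app3 w (f x) (f y) (f z) - app3 \<mu> (f x) (f y) (f z))"
          using assms(5) by (simp add: \<Phi>_def simps three_lie_morphism_def)
        also have "norm \<dots> \<le> c * \<delta> * (norm x * norm y * norm z)"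
          unfolding norm_minus_cancel c_def
          using \<delta> by (intro app3_diff_le[OF close] f_le) simp_all
        finally show "norm (\<Phi> 0 x y z) \<le> c * \<delta> * (norm x * norm y * norm z)" .
      qed (use c \<delta> in simp)
      then show "norm (\<Phi> 0) \<le> e * r"
        using \<delta> by simp
    next
      fix u :: "'g \<Rightarrow>\<^sub>L 'h" assume u: "norm u \<le> r"
      define \<theta> where "\<theta> = \<Phi> u"
      have \<theta>_le: "norm (\<theta> x y z) \<le> norm \<theta> * (norm x * norm y * norm z)" for x y z
      proof -
        have "norm (\<theta> x y z) \<le> norm \<theta> * norm x * norm y * norm z"
          by (meson mult_right_mono norm_blinfun norm_ge_zero order_trans)
        then show ?thesis
          by (simp add: mult.assoc)
      qed
      have "norm (d2 \<pi> \<mu> f \<theta>) \<le> 4 * (c * \<rho>) * norm \<theta>"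
      proof (intro norm_blinfun_bound)
        fix x1 y1 x2 y2 z
        let ?F = "f + u"
        \<comment> \<open>Subtracting this zero from \<open>d2 \<pi> \<mu> f \<theta>\<close>
          removes all terms through \<open>\<pi>\<close> and leaves four differences of brackets,
          each small relative to \<open>\<theta>\<close>.\<close>
        have "d2_fun \<pi> w ?F \<theta> x1 y1 x2 y2 z = 0"
          unfolding \<theta>_def \<Phi>_def by (rule d2_morphism_defect[OF fd(1) assms(3) w])
        then have "d2 \<pi> \<mu> f \<theta> x1 y1 x2 y2 z =
             (app3 w (?F x2) (?F y2) (\<theta> x1 y1 z) - app3 \<mu> (f x2) (f y2) (\<theta> x1 y1 z))
           - (app3 w (?F x1) (?F y1) (\<theta> x2 y2 z) - app3 \<mu> (f x1) (f y1) (\<theta> x2 y2 z))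
           + (app3 w (\<theta> x1 y1 x2) (?F y2) (?F z) - app3 \<mu> (\<theta> x1 y1 x2) (f y2) (f z))
           + (app3 w (?F x2) (\<theta> x1 y1 y2) (?F z) - app3 \<mu> (f x2) (\<theta> x1 y1 y2) (f z))"
          unfolding d2_apply[OF fd(1)] d2_fun_def by (simp add: algebra_simps)
        then have "norm (d2 \<pi> \<mu> f \<theta> x1 y1 x2 y2 z) \<le>
             norm (app3 w (?F x2) (?F y2) (\<theta> x1 y1 z) - app3 \<mu> (f x2) (f y2) (\<theta> x1 y1 z))
           + norm (app3 w (?F x1) (?F y1) (\<theta> x2 y2 z) - app3 \<mu> (f x1) (f y1) (\<theta> x2 y2 z))
           + norm (app3 w (\<theta> x1 y1 x2) (?F y2) (?F z) - app3 \<mu> (\<theta> x1 y1 x2) (f y2) (f z))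
           + norm (app3 w (?F x2) (\<theta> x1 y1 y2) (?F z) - app3 \<mu> (f x2) (\<theta> x1 y1 y2) (f z))"
          by (simp only:) (intro norm_triangle_le add_right_mono norm_triangle_ineq4)
        also have "\<dots> \<le>
             c * \<rho> * (norm x2 * norm y2 * (norm \<theta> * (norm x1 * norm y1 * norm z)))
           + c * \<rho> * (norm x1 * norm y1 * (norm \<theta> * (norm x2 * norm y2 * norm z)))
           + c * \<rho> * ((norm \<theta> * (norm x1 * norm y1 * norm x2)) * norm y2 * norm z)
           + c * \<rho> * (norm x2 * (norm \<theta> * (norm x1 * norm y1 * norm y2)) * norm z)"
          by (intro add_mono diff same[OF \<theta>_le] f_le fu_le fu_diff u)
        also have "\<dots> = 4 * (c * \<rho>) * norm \<theta> * norm x1 * norm y1 * norm x2 * norm y2 * norm z"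
          by simp
        finally show "norm (d2 \<pi> \<mu> f \<theta> x1 y1 x2 y2 z)
            \<le> 4 * (c * \<rho>) * norm \<theta> * norm x1 * norm y1 * norm x2 * norm y2 * norm z" .
      qed (use c \<rho> in simp_all)
      also have "\<dots> \<le> e * norm \<theta>"
        using \<rho>(3) by (intro mult_right_mono) auto
      finally show "norm (d2 \<pi> \<mu> f (\<Phi> u)) \<le> e * norm (\<Phi> u)"
        by (simp add: \<theta>_def)
    qed
    then obtain u where u: "norm u \<le> r" "\<Phi> u = 0"
      by blast
    have "morphism_defect \<pi> w (f + u) x y z = 0" for x y z
      using u(2) by (simp add: \<Phi>_def)
    then have "three_lie_morphism \<pi> w (f + u)"
      by (simp add: three_lie_morphism_def simps)
    moreover have "f + u \<in> V"
      using u(1) r r0 by (auto simp: dist_norm)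
    ultimately show ?thesis
      by blast
  qed
  show "\<exists>W. openin (top_of_set alternating3) W \<and> \<mu> \<in> W \<and>
      (\<forall>w\<in>W. three_lie_structure w \<longrightarrow> (\<exists>f'\<in>V. three_lie_morphism \<pi> w f'))"
  proof (intro exI conjI ballI impI)
    show "openin (top_of_set alternating3) (alternating3 \<inter> ball \<mu> \<delta>)"
      by (intro openin_open_Int open_ball)
    show "\<mu> \<in> alternating3 \<inter> ball \<mu> \<delta>"
      using assms(4) \<delta> unfolding three_lie_structure_def by simp
    fix w assume "w \<in> alternating3 \<inter> ball \<mu> \<delta>" "three_lie_structure w"
    then show "\<exists>f'\<in>V. three_lie_morphism \<pi> w f'"
      by (intro ex) (auto simp: dist_norm norm_minus_commute)
  qed
qed

end
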